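(* Let $n\geq 2$, let $A,Z$ be two countable, compact subsets of the sphere $\mathbb{S}^n$, and let $h: A \to Z$ be a homeomorphism. Then there is a homeomorphism $h'$ from $\mathbb{S}^n$ onto itself extending $h$ (that is, $h'|_A = h$). Moreover, $h'$ can be chosen to be orientation reversing, and it can also be chosen to be orientation preserving.
   Context: $\mathbb{S}^n$ denotes the standard $n$-dimensional sphere; $A$ and $Z$ carry the subspace topology. *)

theory Defs
  imports "HOL-Homology.Homology"
begin

text \<open>The action of a self-homeomorphism of the sphere on the top reduced homology group, which is
  infinite cyclic, is multiplication by its degree, and this degree is 1 or -1.\<close>

definition orientation_preserving :: "nat \<Rightarrow> ((nat \<Rightarrow> real) \<Rightarrow> nat \<Rightarrow> real) \<Rightarrow> bool" where
  "orientation_preserving n f \<longleftrightarrow>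
     homeomorphic_map (nsphere n) (nsphere n) f \<and> Brouwer_degree2 n f = 1"

definition orientation_reversing :: "nat \<Rightarrow> ((nat \<Rightarrow> real) \<Rightarrow> nat \<Rightarrow> real) \<Rightarrow> bool" where
  "orientation_reversing n f \<longleftrightarrow>
     homeomorphic_map (nsphere n) (nsphere n) f \<and> Brouwer_degree2 n f = -1"

end

theory Submission
  imports Defs
begin

text \<open>
  A pole outside the countable set \<open>A \<union> Z\<close> turns the problem into one about compact countable subsets of
  \<open>\<real>\<^sup>n\<close>. There Klee's trick applies. The functional \<open>m\<^sub>t x = \<Sum>i. x\<^sub>i t\<^sup>i\<close> separates the points
  of a countable set for all but countably many \<open>t\<close>; choose \<open>t \<noteq> s\<close> such that \<open>m\<^sub>t\<close> is injective on \<open>A\<close>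
  and \<open>m\<^sub>s\<close> on \<open>Z\<close>. For \<open>a \<in> A\<close> there is a point \<open>w a\<close> of a fixed plane with
  \<open>m\<^sub>t (w a) = m\<^sub>t a\<close> and \<open>m\<^sub>s (w a) = m\<^sub>s (h a)\<close>. By Tietze's theorem a shear \<open>x \<mapsto> x + G (m\<^sub>t x)\<close>
  with \<open>m\<^sub>t \<circ> G = 0\<close> carries \<open>a\<close> to \<open>w a\<close>, and a shear along the level sets of \<open>m\<^sub>s\<close> carries \<open>w a\<close> to
  \<open>h a\<close>.

  Each shear is the square of the shear with half the displacement, so its extension to the sphere
  is a square of a homeomorphism and has degree 1. An orientation reversing extension of \<open>h\<close> is
  obtained by composing a reflection \<open>r\<close> with an extension of degree 1 of \<open>h \<circ> r\<close> from \<open>r ` A\<close>.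
\<close>

section \<open>Set models of Euclidean space and the sphere among sequences with zero tail\<close>

definition coord_space :: "nat \<Rightarrow> (nat \<Rightarrow> real) set" where
  "coord_space n = {x. \<forall>i\<ge>n. x i = 0}"

definition unit_sphere :: "nat \<Rightarrow> (nat \<Rightarrow> real) set" where
  "unit_sphere n = {x. (\<Sum>i\<le>n. (x i)\<^sup>2) = 1 \<and> (\<forall>i>n. x i = 0)}"

text \<open>The product topology on \<open>nat \<Rightarrow> real\<close> is its type class
  topology, so the set-based notions \<open>compact\<close>, \<open>continuous_on\<close> and
  \<open>homeomorphism\<close> apply to the sphere.\<close>

lemma nsphere_eq_top_of_set: "nsphere n = top_of_set (unit_sphere n)"
  by (simp add: nsphere euclidean_product_topology unit_sphere_def)

lemma homeomorphic_maps_top_of_set_iff: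
  "homeomorphic_maps (top_of_set S) (top_of_set T) f g \<longleftrightarrow> homeomorphism S T f g"
  unfolding homeomorphic_maps_def
  by (auto simp: homeomorphism_def image_subset_iff_funcset Pi_iff image_iff set_eq_iff; metis)

lemma continuous_on_coordinate [continuous_intros]:
  "continuous_on S (\<lambda>x. x i :: 'c::topological_space)"
  by (rule continuous_on_subset [OF continuous_on_product_coordinates subset_UNIV])

text \<open>The sphere is a closed subset of an infinite product of intervals [-1,1], which is
  compact by Tychonoff's theorem.\<close>

lemma compact_unit_sphere: "compact (unit_sphere n)"
proof -
  let ?B = "PiE UNIV (\<lambda>i::nat. {-1..1::real})"
  have "compactin (product_topology (\<lambda>i::nat. euclideanreal) UNIV) ?B"
    by (simp add: compactin_PiE)
  then have "compact ?B"
    by (simp add: euclidean_product_topology)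
  moreover have "closed (unit_sphere n)"
  proof -
    have eq: "unit_sphere n = {x. (\<Sum>i\<le>n. (x i)\<^sup>2) = 1} \<inter> (\<Inter>i\<in>{n<..}. {x. x i = 0})"
      by (auto simp: unit_sphere_def)
    show ?thesis
      unfolding eq
      by (intro closed_Int closed_INT ballI closed_Collect_eq continuous_intros)
  qed
  moreover have "unit_sphere n \<subseteq> ?B"
  proof
    fix x assume x: "x \<in> unit_sphere n"
    have "x i \<in> {-1..1}" for i
    proof (cases "i \<le> n")
      case True
      then have "(x i)\<^sup>2 \<le> (\<Sum>i\<le>n. (x i)\<^sup>2)"
        by (intro member_le_sum) auto
      then show ?thesis
        using x by (simp add: unit_sphere_def abs_square_le_1 abs_le_iff)
    qed (use x in \<open>auto simp: unit_sphere_def\<close>)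
    then show "x \<in> ?B"
      by auto
  qed
  ultimately show ?thesis
    by (metis closed_Int_compact inf.absorb1)
qed

section \<open>Punctured compact spaces\<close>

text \<open>An open \<open>U\<close> containing \<open>p\<close> has a compact complement, and the
  complement of its preimage is the image of that compact set under \<open>g\<close>. This image is
  compact, hence closed.\<close>

lemma continuous_on_extend_puncture:
  fixes S :: "'a::t2_space set"
  assumes "compact S" "p \<in> S" and hom: "homeomorphism (S - {p}) (S - {p}) f g"
  shows "continuous_on S (f(p := p))"
proof -
  have fim: "f ` (S - {p}) = S - {p}" and gim: "g ` (S - {p}) = S - {p}"
    and gf: "\<And>x. x \<in> S - {p} \<Longrightarrow> g (f x) = x" and fg: "\<And>x. x \<in> S - {p} \<Longrightarrow> f (g x) = x"
    and contf: "continuous_on (S - {p}) f" and contg: "continuous_on (S - {p}) g"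
    using hom by (auto simp: homeomorphism_def)
  have maps: "f(p := p) \<in> S \<rightarrow> S"
    using imageI [of _ "S - {p}" f] assms(2) unfolding fim by auto
  have "openin (top_of_set S) (S \<inter> (f(p := p)) -` U)" if U: "openin (top_of_set S) U" for U
  proof (cases "p \<in> U")
    case True
    have US: "U \<subseteq> S"
      using U by (rule openin_imp_subset)
    have "closedin (top_of_set S) (S - U)"
      using U by (simp add: closedin_diff)
    then have "compact (S - U)"
      using assms(1) closedin_compact by blast
    then have "compact (g ` (S - U))"
      by (rule compact_continuous_image [rotated]) (use contg True in \<open>auto intro: continuous_on_subset\<close>)
    moreover have gsub: "g ` (S - U) \<subseteq> S"
      using gim True by blast
    ultimately have "closedin (top_of_set S) (g ` (S - U))"
      by (simp add: closed_subset compact_imp_closed)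
    then have "openin (top_of_set S) (S - g ` (S - U))"
      by (simp add: openin_diff)
    moreover have "S \<inter> (f(p := p)) -` U = S - g ` (S - U)"
    proof (intro equalityI subsetI)
      fix x assume x: "x \<in> S \<inter> (f(p := p)) -` U"
      have "x \<noteq> g y" if y: "y \<in> S - U" for y
      proof -
        have "y \<in> S - {p}"
          using y True by blast
        then have "g y \<noteq> p" "f (g y) = y"
          using gim fg by blast+
        then show ?thesis
          using x y by auto
      qed
      then show "x \<in> S - g ` (S - U)"
        using x by blast
    next
      fix x assume x: "x \<in> S - g ` (S - U)"
      show "x \<in> S \<inter> (f(p := p)) -` U"
      proof (cases "x = p")
        case False
        then have "g (f x) = x" "f x \<in> S"
          using gf fim x by auto
        then have "f x \<in> U"
          using x by (metis DiffD2 DiffI image_eqI)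
        then show ?thesis
          using x False by simp
      qed (use x True in simp)
    qed
    ultimately show ?thesis
      by simp
  next
    case False
    \<comment> \<open>Away from \<open>p\<close>, continuity of \<open>f\<close> gives openness
      relative to \<open>S - {p}\<close>, which is itself open in \<open>S\<close>.\<close>
    have "openin (top_of_set (S - {p})) U"
      using U False openin_imp_subset by (intro openin_subset_trans [OF U]) blast+
    then have "openin (top_of_set (S - {p})) ((S - {p}) \<inter> f -` U)"
      using contf fim continuous_on_open_gen [of f "S - {p}" "S - {p}"] by blast
    moreover have "openin (top_of_set S) (S - {p})"
      by (simp add: openin_delete)
    ultimately have "openin (top_of_set S) ((S - {p}) \<inter> f -` U)"
      by (rule openin_trans)
    moreover have "S \<inter> (f(p := p)) -` U = (S - {p}) \<inter> f -` U"
      using False by (auto split: if_splits)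
    ultimately show ?thesis
      by simp
  qed
  then show ?thesis
    using continuous_on_open_gen [OF maps] by blast
qed

lemma homeomorphism_extend_puncture:
  fixes S :: "'a::t2_space set"
  assumes "compact S" "p \<in> S" and hom: "homeomorphism (S - {p}) (S - {p}) f g"
  shows "homeomorphism S S (f(p := p)) (g(p := p))"
proof
  show "continuous_on S (f(p := p))" "continuous_on S (g(p := p))"
    using continuous_on_extend_puncture assms homeomorphism_symD by blast+
qed (use assms in \<open>auto simp: homeomorphism_def\<close>)

section \<open>The sphere minus a point\<close>

text \<open>Stereographic projection from the pole \<open>e\<close>: \<open>f x\<close> is where the
  line through \<open>e\<close> and \<open>x\<close> meets the hyperplane of height 0, and
  \<open>g y\<close> is the second point of the sphere on the line through \<open>e\<close> and
  \<open>y\<close>.\<close>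

lemma homeomorphism_stereographic:
  fixes n :: nat
  defines "e \<equiv> (\<lambda>i. if i = n then 1 else 0 :: real)"
  shows "\<exists>f g. homeomorphism (unit_sphere n - {e}) (coord_space n) f g"
proof -
  define f where "f = (\<lambda>(x::nat \<Rightarrow> real) i. if i < n then x i / (1 - x n) else 0)"
  define N where "N = (\<lambda>y::nat \<Rightarrow> real. \<Sum>i<n. (y i)\<^sup>2)"
  define g where "g = (\<lambda>y i. if i < n then 2 * y i / (N y + 1)
                              else if i = n then (N y - 1) / (N y + 1) else 0)"
  have N: "N y = (\<Sum>i<n. (y i)\<^sup>2)" for y
    by (simp add: N_def)
  have Npos: "N y + 1 > 0" for y
    unfolding N_def by (smt (verit) sum_nonneg zero_le_power2)
  have sph: "x \<in> unit_sphere n \<longleftrightarrow> N x + (x n)\<^sup>2 = 1 \<and> (\<forall>i>n. x i = 0)" for x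
    by (simp add: unit_sphere_def N_def flip: lessThan_Suc_atMost)
  \<comment> \<open>A point of the sphere of height at least 1 has all other coordinates zero, so it
    is the pole. This makes the denominator of \<open>f\<close> positive.\<close>
  have xn: "x n < 1" if "x \<in> unit_sphere n - {e}" for x
  proof (rule ccontr)
    assume "\<not> x n < 1"
    then have "(x n)\<^sup>2 \<ge> 1"
      by (simp add: one_le_power)
    moreover have x: "N x + (x n)\<^sup>2 = 1" "\<forall>i>n. x i = 0" "N x \<ge> 0"
      using that sph by (auto simp: N_def sum_nonneg)
    ultimately have "(x n)\<^sup>2 = 1" "N x = 0"
      by auto
    then have "x n = 1" "\<forall>i<n. x i = 0"
      using \<open>\<not> x n < 1\<close> by (auto simp: power2_eq_1_iff N_def sum_nonneg_eq_0_iff)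
    then have "x = e"
      using x(2) by (auto simp: e_def fun_eq_iff) (metis linorder_neqE_nat)
    then show False
      using that by simp
  qed
  \<comment> \<open>The squared norm of the image determines the height \<open>x n\<close>; this is
    how \<open>g\<close> recovers \<open>x\<close>.\<close>
  have Nf: "N (f x) = (1 + x n) / (1 - x n)" if "x \<in> unit_sphere n - {e}" for x
  proof -
    have "N (f x) = N x / (1 - x n)\<^sup>2"
      by (simp add: N_def f_def power_divide sum_divide_distrib)
    also have "N x = (1 + x n) * (1 - x n)"
      using that sph by (simp add: algebra_simps power2_eq_square)
    finally show ?thesis
      using xn [OF that] by (simp add: power2_eq_square)
  qed
  have "homeomorphism (unit_sphere n - {e}) (coord_space n) f g"
  proof
    show "continuous_on (unit_sphere n - {e}) f"
    proof (rule continuous_on_coordinatewise_then_product)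
      fix i
      have "continuous_on (unit_sphere n - {e}) (\<lambda>x. x i / (1 - x n))"
        using xn by (intro continuous_intros) force+
      then show "continuous_on (unit_sphere n - {e}) (\<lambda>x. f x i)"
        by (cases "i < n") (auto simp: f_def)
    qed
    have contN: "continuous_on (coord_space n) N"
      unfolding N_def by (intro continuous_intros)
    show "continuous_on (coord_space n) g"
    proof (rule continuous_on_coordinatewise_then_product)
      fix i
      have "continuous_on (coord_space n) (\<lambda>y. 2 * y i / (N y + 1))"
           "continuous_on (coord_space n) (\<lambda>y. (N y - 1) / (N y + 1))"
        using Npos by (intro continuous_intros contN; metis less_irrefl)+
      then show "continuous_on (coord_space n) (\<lambda>x. g x i)"
        by (cases "i < n"; cases "i = n") (auto simp: g_def)
    qed
    show "f ` (unit_sphere n - {e}) \<subseteq> coord_space n"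
      by (auto simp: f_def coord_space_def)
    show "g ` coord_space n \<subseteq> unit_sphere n - {e}"
    proof clarsimp
      fix y assume "y \<in> coord_space n"
      have "N (g y) = (\<Sum>i<n. 4 / (N y + 1)\<^sup>2 * (y i)\<^sup>2)"
        using N [of "g y"] by (simp add: g_def power_divide power_mult_distrib)
      also have "\<dots> = 4 * N y / (N y + 1)\<^sup>2"
        unfolding sum_distrib_left [symmetric] by (simp add: N)
      finally have "N (g y) + (g y n)\<^sup>2 = (4 * N y + (N y - 1)\<^sup>2) / (N y + 1)\<^sup>2"
        by (simp add: g_def power_divide add_divide_distrib)
      also have "4 * N y + (N y - 1)\<^sup>2 = (N y + 1)\<^sup>2"
        by (simp add: power2_eq_square algebra_simps)
      finally have "N (g y) + (g y n)\<^sup>2 = 1"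
        using Npos [of y] by simp
      then have "g y \<in> unit_sphere n"
        by (simp add: sph) (simp add: g_def)
      moreover have "g y n \<noteq> e n"
        using Npos [of y] by (simp add: g_def e_def divide_eq_eq)
      ultimately show "g y \<in> unit_sphere n \<and> g y \<noteq> e"
        by metis
    qed
    show "g (f x) = x" if x: "x \<in> unit_sphere n - {e}" for x
    proof
      fix i
      have *: "1 - x n > 0"
        using xn [OF x] by simp
      have "N (f x) + 1 = 2 / (1 - x n)" "N (f x) - 1 = 2 * x n / (1 - x n)"
        using * by (auto simp: Nf [OF x] field_simps)
      then show "g (f x) i = x i"
        using * x by (auto simp: g_def f_def sph)
    qed
    show "f (g y) = y" if "y \<in> coord_space n" for y
    proof
      fix i
      have "1 - g y n = 2 / (N y + 1)"
        using Npos [of y] by (simp add: g_def field_simps)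
      then show "f (g y) i = y i"
        using Npos [of y] that by (simp add: f_def coord_space_def) (simp add: g_def)
    qed
  qed
  then show ?thesis
    by blast
qed

text \<open>An orthogonal reflection moves \<open>p\<close> to the pole \<open>e\<close>, where the
  stereographic formula applies.\<close>

lemma homeomorphism_punctured_sphere:
  assumes p: "p \<in> unit_sphere n"
  shows "\<exists>f g. homeomorphism (unit_sphere n - {p}) (coord_space n) f g"
proof -
  define e where "e = (\<lambda>i. if i = n then 1 else 0 :: real)"
  define ip where "ip = (\<lambda>x y::nat \<Rightarrow> real. \<Sum>i\<le>n. x i * y i)"
  define v where "v = (\<lambda>i. p i - e i)"
  \<comment> \<open>The Householder reflection exchanging \<open>p\<close> and \<open>e\<close>;
    for \<open>p = e\<close> the junk value \<open>1/0 = 0\<close> makes it the identity.\<close>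
  define R where "R = (\<lambda>x i. x i - 2 * (ip x v / ip v v) * v i)"
  have sph: "x \<in> unit_sphere n \<longleftrightarrow> ip x x = 1 \<and> (\<forall>i>n. x i = 0)" for x
    by (simp add: unit_sphere_def ip_def power2_eq_square)
  have lin: "ip (\<lambda>i. x i - c * v i) y = ip x y - c * ip v y" for x y c
    by (simp add: ip_def algebra_simps sum_subtractf sum_distrib_left)
  have comm: "ip x y = ip y x" for x y
    by (simp add: ip_def mult.commute)
  have ipe: "ip x e = x n" for x
    by (simp add: ip_def e_def if_distrib cong: if_cong)
  have e: "e \<in> unit_sphere n"
    unfolding sph ipe by (simp add: e_def)
  have vtail: "v i = 0" if "i > n" for i
    using p e that by (simp add: v_def sph)
  have v0: "v = (\<lambda>i. 0)" if "ip v v = 0"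
  proof
    fix i
    have "\<forall>i\<le>n. v i = 0"
      using that by (simp add: ip_def sum_nonneg_eq_0_iff)
    then show "v i = 0"
      using vtail by (meson not_le_imp_less)
  qed
  have ipR: "ip (R x) y = ip x y - 2 * (ip x v / ip v v) * ip v y" for x y
    unfolding R_def by (rule lin)
  have Rv: "ip (R x) v = - ip x v" for x
  proof (cases "ip v v = 0")
    case True
    then show ?thesis using v0 by (simp add: ipR) (simp add: ip_def)
  qed (simp add: ipR)
  have R: "R x i = x i - 2 * (ip x v / ip v v) * v i" for x i
    by (simp add: R_def)
  have RR: "R (R x) = x" for x
    by (rule ext) (simp add: R [of "R x"] Rv, simp add: R)
  have Rip: "ip (R x) (R x) = ip x x" for x
  proof -
    have "ip (R x) (R x) = ip (R x) x - 2 * (ip x v / ip v v) * ip (R x) v"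
      using ipR [of x "R x"] comm by metis
    then show ?thesis
      unfolding Rv by (simp add: ipR comm [of v x])
  qed
  have Rsph: "R x \<in> unit_sphere n" if "x \<in> unit_sphere n" for x
    using that vtail by (simp add: sph Rip) (simp add: R_def)
  \<comment> \<open>For \<open>p \<noteq> e\<close> the quotient \<open>ip p v / ip v v\<close> is
    thus 1/2, so \<open>R p = p - v = e\<close>.\<close>
  have "ip p v = 1 - p n" "ip v v = 2 * (1 - p n)"
  proof -
    have l: "ip v y = ip p y - ip e y" for y
      by (simp add: v_def ip_def algebra_simps sum_subtractf)
    have "ip p p = 1" "ip e e = 1" "ip p e = p n" "ip e p = p n"
      using p e sph ipe comm by metis+
    then have "ip v p = 1 - p n" "ip v e = p n - 1"
      using l by simp_all
    then show "ip p v = 1 - p n" "ip v v = 2 * (1 - p n)"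
      using l [of v] comm [of p v] comm [of e v] by simp_all
  qed
  then have Rp: "R p = e"
  proof (cases "ip v v = 0")
    case True
    have "p = e"
      using v0 [OF True] by (simp add: v_def fun_eq_iff)
    moreover have "R p = p"
      using v0 [OF True] by (simp add: R_def)
    ultimately show ?thesis
      by simp
  qed (auto simp: R_def v_def fun_eq_iff)
  have contR: "continuous_on S R" for S
  proof (rule continuous_on_coordinatewise_then_product)
    show "continuous_on S (\<lambda>x. R x i)" for i
      unfolding R_def ip_def divide_inverse by (intro continuous_intros)
  qed
  have "homeomorphism (unit_sphere n - {p}) (unit_sphere n - {e}) R R"
  proof (rule homeomorphismI)
    have "R e = p"
      using RR Rp by metis
    then show "R ` (unit_sphere n - {p}) \<subseteq> unit_sphere n - {e}" "R ` (unit_sphere n - {e}) \<subseteq> unit_sphere n - {p}"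
      using RR Rsph Rp by (smt (verit) Diff_iff image_subsetI singleton_iff)+
  qed (use contR RR in auto)
  moreover obtain f g where "homeomorphism (unit_sphere n - {e}) (coord_space n) f g"
    unfolding e_def using homeomorphism_stereographic by blast
  ultimately show ?thesis
    using homeomorphism_compose by blast
qed

text \<open>The first two coordinates already contain an arc of the unit circle, parametrized
  injectively by an open interval.\<close>

lemma uncountable_unit_sphere:
  assumes "n \<ge> 1"
  shows "uncountable (unit_sphere n)"
proof
  define w where "w = (\<lambda>c::real. \<lambda>i::nat. if i = 0 then c else if i = 1 then sqrt (1 - c\<^sup>2) else 0)"
  assume "countable (unit_sphere n)"
  moreover have "w ` {0<..<1} \<subseteq> unit_sphere n"
  proof clarify
    fix c :: real assume c: "c \<in> {0<..<1}"
    have "(\<Sum>i\<le>n. (w c i)\<^sup>2) = (\<Sum>i\<in>{0,1}. (w c i)\<^sup>2)"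
      using assms by (intro sum.mono_neutral_right) (auto simp: w_def)
    also have "\<dots> = 1"
      using c by (simp add: w_def abs_square_le_1)
    finally show "w c \<in> unit_sphere n"
      using assms by (auto simp: unit_sphere_def w_def)
  qed
  ultimately have "countable (w ` {0<..<1})"
    using countable_subset by blast
  moreover have "inj_on w {0<..<1}"
    by (rule inj_onI) (metis (full_types) w_def)
  ultimately have "countable {0<..<1::real}"
    using countable_image_inj_on by blast
  then show False
    using uncountable_open_interval [of 0 "1::real"] by simp
qed

section \<open>Shears of Euclidean space\<close>

text \<open>The value at \<open>t\<close> of the polynomial with coefficients \<open>x i\<close>.
  The term with index \<open>n\<close> vanishes on \<open>coord_space n\<close>; including it keeps
  index 0 in the sum for every \<open>n\<close>.\<close>

definition moment :: "nat \<Rightarrow> real \<Rightarrow> (nat \<Rightarrow> real) \<Rightarrow> real" where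
  "moment n t x = (\<Sum>i\<le>n. x i * t ^ i)"

lemma continuous_on_moment [continuous_intros]:
  assumes "continuous_on S f"
  shows "continuous_on S (\<lambda>x. moment n t (f x))"
  unfolding moment_def
  by (intro continuous_intros continuous_on_product_then_coordinatewise [OF assms])

text \<open>Two distinct points have equal moments only at the roots of the nonzero polynomial with
  coefficients \<open>a i - b i\<close>; there are countably many pairs and finitely many roots for
  each.\<close>

lemma countable_not_inj_on_moment:
  assumes "countable A" "A \<subseteq> coord_space n"
  shows "countable {t. \<not> inj_on (moment n t) A}"
proof -
  have "finite {t. moment n t a = moment n t b}" if ab: "a \<in> A" "b \<in> A" "a \<noteq> b" for a b
  proof -
    obtain i where i: "a i \<noteq> b i"
      using ab(3) by (metis ext)
    moreover have "i \<le> n"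
    proof (rule ccontr)
      assume "\<not> i \<le> n"
      then have "a i = 0" "b i = 0"
        using ab(1,2) assms(2) by (auto simp: coord_space_def)
      then show False
        using i by simp
    qed
    ultimately have "finite {t. (\<Sum>i\<le>n. (a i - b i) * t ^ i) = 0}"
      using polyfun_finite_roots [of "\<lambda>i. a i - b i" n] by auto
    then show ?thesis
      by (simp add: moment_def left_diff_distrib sum_subtractf)
  qed
  then have "countable (\<Union>a\<in>A. \<Union>b\<in>A - {a}. {t. moment n t a = moment n t b})"
    using assms(1) by (intro countable_UN) (auto intro: countable_finite)
  moreover have "{t. \<not> inj_on (moment n t) A} \<subseteq> (\<Union>a\<in>A. \<Union>b\<in>A - {a}. {t. moment n t a = moment n t b})"
    unfolding inj_on_def by blast
  ultimately show ?thesis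
    using countable_subset by blast
qed

text \<open>The displacement lies in the kernel of the functional, so a point and its image have the
  same moment, and subtracting the same displacement undoes the shear.\<close>

lemma homeomorphism_shear:
  assumes G: "continuous_on UNIV G" "\<And>c. G c \<in> coord_space n" "\<And>c. moment n t (G c) = 0"
  shows "homeomorphism (coord_space n) (coord_space n)
           (\<lambda>x i. x i + G (moment n t x) i) (\<lambda>x i. x i - G (moment n t x) i)"
proof -
  have m: "moment n t (\<lambda>i. x i + G c i) = moment n t x" "moment n t (\<lambda>i. x i - G c i) = moment n t x" for x c
    using G(3) [of c] by (simp_all add: moment_def algebra_simps sum.distrib sum_subtractf)
  have c: "continuous_on (coord_space n) (\<lambda>x. G (moment n t x))"
    by (rule continuous_on_compose2 [OF G(1)]) (auto intro!: continuous_intros)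
  show ?thesis
  proof
    show "continuous_on (coord_space n) (\<lambda>x i. x i + G (moment n t x) i)"
      "continuous_on (coord_space n) (\<lambda>x i. x i - G (moment n t x) i)"
      by (intro continuous_intros continuous_on_product_then_coordinatewise [OF c])+
  qed (use G(2) in \<open>auto simp: m coord_space_def\<close>)
qed

text \<open>By injectivity the displacement \<open>f x - x\<close> is a continuous function of the
  moment on a compact set of reals; Tietze's theorem extends it to the line, one coordinate at a
  time.\<close>

lemma shear_realize:
  assumes K: "compact K" "K \<subseteq> coord_space n" and inj: "inj_on (moment n t) K"
    and f: "continuous_on K f" "f ` K \<subseteq> coord_space n"
    and mf: "\<And>x. x \<in> K \<Longrightarrow> moment n t (f x) = moment n t x"
  shows "\<exists>Q Q'. homeomorphism (coord_space n) (coord_space n) Q Q' \<and> (\<forall>x\<in>K. Q (Q x) = f x)"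
proof -
  let ?m = "moment n t"
  have contm: "continuous_on K ?m"
    by (intro continuous_intros)
  define r where "r = the_inv_into K ?m"
  have r: "r (?m x) = x" if "x \<in> K" for x
    unfolding r_def using inj that by (rule the_inv_into_f_f)
  have contr: "continuous_on (?m ` K) r"
    unfolding r_def using contm K(1) inj by (rule continuous_on_inv_into)
  have rim: "r ` (?m ` K) \<subseteq> K"
    using r by auto
  have closed: "closedin (top_of_set UNIV) (?m ` K)"
    using compact_continuous_image [OF contm K(1)] by (simp add: compact_imp_closed)
  have "\<exists>g. continuous_on UNIV g \<and> (\<forall>c\<in>?m ` K. g c = f (r c) i - r c i)" for i
  proof -
    have "continuous_on (?m ` K) (\<lambda>c. f (r c))"
      by (rule continuous_on_compose2 [OF f(1) contr rim])
    then have "continuous_on (?m ` K) (\<lambda>c. f (r c) i)"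
      by (rule continuous_on_product_then_coordinatewise)
    then have "continuous_on (?m ` K) (\<lambda>c. f (r c) i - r c i)"
      by (rule continuous_on_diff [OF _ continuous_on_product_then_coordinatewise [OF contr]])
    then obtain g where "continuous_on UNIV g" "\<And>c. c \<in> ?m ` K \<Longrightarrow> g c = f (r c) i - r c i"
      using Tietze_unbounded [OF _ closed] by blast
    then show ?thesis
      by blast
  qed
  then obtain g where g: "\<And>i. continuous_on UNIV (g i)"
      "\<And>i c. c \<in> ?m ` K \<Longrightarrow> g i c = f (r c) i - r c i"
    by metis
  define G0 where "G0 = (\<lambda>c i. if i < n then g i c else 0)"
  \<comment> \<open>The halved displacement: the shear by \<open>G\<close> applied twice is the shear by \<open>2 G\<close>.\<close>
  define G where "G = (\<lambda>c i. (G0 c i - (if i = 0 then ?m (G0 c) else 0)) / 2)"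
  have contG0: "continuous_on UNIV G0"
  proof (rule continuous_on_coordinatewise_then_product)
    show "continuous_on UNIV (\<lambda>c. G0 c i)" for i
      using g(1) by (cases "i < n") (auto simp: G0_def)
  qed
  have "continuous_on UNIV G"
  proof (rule continuous_on_coordinatewise_then_product)
    have "continuous_on UNIV (\<lambda>c. (G0 c i - ?m (G0 c)) / 2)" "continuous_on UNIV (\<lambda>c. (G0 c i - 0) / 2)" for i
      by (intro continuous_intros contG0 continuous_on_product_then_coordinatewise [OF contG0]; simp)+
    then show "continuous_on UNIV (\<lambda>c. G c i)" for i
      by (cases "i = 0") (auto simp: G_def)
  qed
  \<comment> \<open>Coordinate 0 has weight \<open>t ^ 0 = 1\<close>, so subtracting
    \<open>?m (G0 c)\<close> there removes exactly the moment of \<open>G0 c\<close>.\<close>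
  moreover have mG: "?m (G c) = 0" for c
  proof -
    have "G c i * t ^ i = (G0 c i * t ^ i - (if i = 0 then ?m (G0 c) else 0)) / 2" for i
      by (simp add: G_def left_diff_distrib)
    then have "?m (G c) = (\<Sum>i\<le>n. (G0 c i * t ^ i - (if i = 0 then ?m (G0 c) else 0)) / 2)"
      by (simp only: moment_def [of n t "G c"])
    also have "\<dots> = (?m (G0 c) - (\<Sum>i\<le>n. if i = 0 then ?m (G0 c) else 0)) / 2"
      by (simp only: sum_divide_distrib [symmetric] sum_subtractf moment_def [symmetric])
    finally show ?thesis
      by simp
  qed
  moreover have "G c \<in> coord_space n" for c
  \<comment> \<open>For \<open>n = 0\<close> the corrected coordinate 0 is outside the allowed
    range, but then \<open>G0 c\<close>, and with it the correction, is zero.\<close>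
  proof (cases "n = 0")
    case True
    then show ?thesis
      by (auto simp: coord_space_def G_def G0_def moment_def)
  qed (auto simp: coord_space_def G_def G0_def)
  ultimately have hom: "homeomorphism (coord_space n) (coord_space n)
      (\<lambda>x i. x i + G (?m x) i) (\<lambda>x i. x i - G (?m x) i)"
    by (intro homeomorphism_shear)
  have "(\<lambda>i. (x i + G (?m x) i) + G (?m (\<lambda>i. x i + G (?m x) i)) i) = f x" if x: "x \<in> K" for x
  proof
    fix i
    have "?m (\<lambda>i. x i + G (?m x) i) = ?m x"
      using mG [of "?m x"] by (simp add: moment_def algebra_simps sum.distrib)
    moreover have G0: "G0 (?m x) i = f x i - x i" for i
      using g(2) r x K(2) f(2) by (auto simp: G0_def coord_space_def subset_iff)
    \<comment> \<open>Since \<open>f\<close> preserves the moment on \<open>K\<close>, the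
      correction vanishes there and two half steps add up to \<open>f x - x\<close>.\<close>
    moreover have "?m (G0 (?m x)) = 0"
      unfolding moment_def [of n t "G0 (?m x)"] G0
      using mf [OF x] by (simp add: algebra_simps sum_subtractf moment_def)
    ultimately show "(x i + G (?m x) i) + G (?m (\<lambda>i. x i + G (?m x) i)) i = f x i"
      by (simp add: G_def)
  qed
  with hom show ?thesis
    by blast
qed

text \<open>A shear preserves its functional, so one alone cannot in general carry \<open>a\<close>
  to \<open>h a\<close>; two with different functionals meet at \<open>w\<close>. The squares are
  kept visible for the degree computation on the sphere.\<close>

lemma extend_coord_space:
  assumes n: "n \<ge> 2" and A: "countable A" "compact A" "A \<subseteq> coord_space n"
    and Z: "countable Z" "compact Z" "Z \<subseteq> coord_space n"
    and h: "homeomorphism A Z h k"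
  shows "\<exists>P P' Q Q'. homeomorphism (coord_space n) (coord_space n) P P' \<and>
           homeomorphism (coord_space n) (coord_space n) Q Q' \<and> (\<forall>a\<in>A. Q (Q (P (P a))) = h a)"
proof -
  have him: "h ` A = Z" and kh: "\<And>a. a \<in> A \<Longrightarrow> k (h a) = a"
    and contk: "continuous_on Z k" and conth: "continuous_on A h"
    using h by (auto simp: homeomorphism_def)
  let ?BA = "{t. \<not> inj_on (moment n t) A}" and ?BZ = "{t. \<not> inj_on (moment n t) Z}"
  have cA: "countable ?BA" and cZ: "countable ?BZ"
    using A Z by (auto intro: countable_not_inj_on_moment)
  obtain t where t: "inj_on (moment n t) A"
    using cA uncountable_UNIV_real by (metis (mono_tags, lifting) UNIV_eq_I mem_Collect_eq)
  \<comment> \<open>Excluding \<open>t\<close> as well makes the two functionals independent on the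
    plane of the first two coordinates.\<close>
  have "countable (insert t ?BZ)"
    using cZ by simp
  then obtain s where "s \<notin> insert t ?BZ"
    using uncountable_UNIV_real by (metis UNIV_eq_I)
  then have s: "inj_on (moment n s) Z" "s \<noteq> t"
    by auto
  \<comment> \<open>The point of the plane of the first two coordinates with \<open>t\<close>-moment \<open>c\<close> and \<open>s\<close>-moment \<open>d\<close>.\<close>
  define w where "w = (\<lambda>c d (i::nat). if i = 0 then c - (c - d) / (t - s) * t
                         else if i = 1 then (c - d) / (t - s) else 0)"
  have w: "w c d \<in> coord_space n" for c d
    using n by (auto simp: w_def coord_space_def)
  have mw: "moment n u (w c d) = w c d 0 + w c d 1 * u" for u c d
  proof -
    have "moment n u (w c d) = (\<Sum>i\<in>{0,1}. w c d i * u ^ i)"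
      unfolding moment_def using n by (intro sum.mono_neutral_right) (auto simp: w_def)
    then show ?thesis
      by simp
  qed
  have mt: "moment n t (w c d) = c" for c d
    by (simp add: mw) (simp add: w_def)
  have ms: "moment n s (w c d) = d" for c d
  proof -
    have "moment n s (w c d) = c - (c - d) / (t - s) * t + (c - d) / (t - s) * s"
      by (simp add: mw) (simp add: w_def)
    also have "\<dots> = c - (c - d) / (t - s) * (t - s)"
      by (simp only: right_diff_distrib)
    also have "\<dots> = d"
      using s(2) by simp
    finally show ?thesis .
  qed
  have contw: "continuous_on S (\<lambda>x. w (f x) (g x))"
    if "continuous_on S f" "continuous_on S g" for S :: "(nat \<Rightarrow> real) set" and f g
  proof (rule continuous_on_coordinatewise_then_product)
    fix i
    have "continuous_on S (\<lambda>x. f x - (f x - g x) / (t - s) * t)"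
      "continuous_on S (\<lambda>x. (f x - g x) / (t - s))"
      using s(2) by (intro continuous_intros that; simp)+
    then show "continuous_on S (\<lambda>x. w (f x) (g x) i)"
      by (cases "i = 0"; cases "i = 1") (auto simp: w_def)
  qed
  have "\<exists>P P'. homeomorphism (coord_space n) (coord_space n) P P' \<and>
          (\<forall>a\<in>A. P (P a) = w (moment n t a) (moment n s (h a)))"
  proof (intro shear_realize [where t = t])
    show "continuous_on A (\<lambda>a. w (moment n t a) (moment n s (h a)))"
      by (intro contw continuous_on_moment continuous_on_id conth)
  qed (use A t w mt in auto)
  then obtain P P' where P: "homeomorphism (coord_space n) (coord_space n) P P'"
      "\<And>a. a \<in> A \<Longrightarrow> P (P a) = w (moment n t a) (moment n s (h a))"
    by blast
  \<comment> \<open>The second shear is built backwards, from \<open>Z\<close> to the intermediate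
    points, because \<open>moment n s\<close> is injective on \<open>Z\<close>; its inverse is used
    below.\<close>
  have "\<exists>Q Q'. homeomorphism (coord_space n) (coord_space n) Q Q' \<and>
          (\<forall>z\<in>Z. Q (Q z) = w (moment n t (k z)) (moment n s z))"
  proof (intro shear_realize [where t = s])
    show "continuous_on Z (\<lambda>z. w (moment n t (k z)) (moment n s z))"
      by (intro contw continuous_on_moment continuous_on_id contk)
  qed (use Z s w ms in auto)
  then obtain Q Q' where Q: "homeomorphism (coord_space n) (coord_space n) Q Q'"
      "\<And>z. z \<in> Z \<Longrightarrow> Q (Q z) = w (moment n t (k z)) (moment n s z)"
    by blast
  have "Q' (Q' (P (P a))) = h a" if "a \<in> A" for a
  proof -
    have ha: "h a \<in> Z"
      using that him by blast
    then have "P (P a) = Q (Q (h a))"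
      using that P(2) Q(2) kh by simp
    moreover have "Q (h a) \<in> coord_space n" "h a \<in> coord_space n"
      using Q(1) ha Z(3) by (auto simp: homeomorphism_def)
    ultimately show ?thesis
      using Q(1) by (simp add: homeomorphism_def)
  qed
  then show ?thesis
    using P(1) homeomorphism_symD [OF Q(1)] by blast
qed

section \<open>Extension with prescribed degree\<close>

text \<open>Degree is multiplicative and is 1 or -1 on homeomorphisms, so the sign of
  \<open>f\<close> itself need not be known.\<close>

lemma homeomorphism_square_degree:
  assumes "homeomorphism (unit_sphere n) (unit_sphere n) f g"
  shows "homeomorphic_map (nsphere n) (nsphere n) (f \<circ> f)" "Brouwer_degree2 n (f \<circ> f) = 1"
proof -
  have f: "homeomorphic_map (nsphere n) (nsphere n) f"
    using assms by (auto simp: homeomorphic_map_maps nsphere_eq_top_of_set homeomorphic_maps_top_of_set_iff)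
  then show "homeomorphic_map (nsphere n) (nsphere n) (f \<circ> f)"
    using homeomorphic_map_compose by blast
  have "Brouwer_degree2 n (f \<circ> f) = (Brouwer_degree2 n f)\<^sup>2"
    using f by (simp add: Brouwer_degree2_compose homeomorphic_imp_continuous_map power2_eq_square)
  also have "\<dots> = 1"
    using Brouwer_degree2_homeomorphic_map [OF f] by (simp add: abs_square_eq_1)
  finally show "Brouwer_degree2 n (f \<circ> f) = 1" .
qed

lemma extend_degree_1:
  assumes n: "n \<ge> 2" and A: "countable A" "compactin (nsphere n) A"
    and Z: "countable Z" "compactin (nsphere n) Z"
    and h: "homeomorphic_map (subtopology (nsphere n) A) (subtopology (nsphere n) Z) h"
  shows "\<exists>h'. homeomorphic_map (nsphere n) (nsphere n) h' \<and> (\<forall>x\<in>A. h' x = h x) \<and>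
           Brouwer_degree2 n h' = 1"
proof -
  let ?S = "unit_sphere n" and ?E = "coord_space n"
  have cA: "A \<subseteq> ?S" "compact A" and cZ: "Z \<subseteq> ?S" "compact Z"
    using A Z by (simp_all add: nsphere_eq_top_of_set compactin_subtopology)
  then have "subtopology (nsphere n) A = top_of_set A" "subtopology (nsphere n) Z = top_of_set Z"
    by (simp_all add: nsphere_eq_top_of_set subtopology_subtopology inf.absorb2)
  with h obtain k where k: "homeomorphism A Z h k"
    by (auto simp: homeomorphic_map_maps homeomorphic_maps_top_of_set_iff)
  have "\<not> ?S \<subseteq> A \<union> Z"
    using uncountable_unit_sphere [of n] n A(1) Z(1) countable_subset by auto
  then obtain p where p: "p \<in> ?S" "p \<notin> A" "p \<notin> Z"
    by blast
  obtain f g where fg: "homeomorphism (?S - {p}) ?E f g"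
    using homeomorphism_punctured_sphere [OF p(1)] by blast
  have AS: "A \<subseteq> ?S - {p}" and ZS: "Z \<subseteq> ?S - {p}"
    using cA cZ p by auto
  have fA: "homeomorphism A (f ` A) f g" and fZ: "homeomorphism Z (f ` Z) f g"
    using homeomorphism_of_subsets [OF fg] AS ZS by (metis order_refl)+
  have "homeomorphism (f ` A) (f ` Z) (f \<circ> (h \<circ> g)) ((f \<circ> k) \<circ> g)"
    using homeomorphism_compose [OF homeomorphism_compose [OF homeomorphism_symD [OF fA] k] fZ] .
  moreover have "f ` A \<subseteq> ?E" "f ` Z \<subseteq> ?E"
    using homeomorphism_image1 [OF fg] AS ZS by blast+
  moreover have "compact (f ` A)" "compact (f ` Z)"
    using compact_continuous_image homeomorphism_cont1 [OF fA] homeomorphism_cont1 [OF fZ] cA(2) cZ(2)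
    by blast+
  ultimately obtain P P' Q Q' where P: "homeomorphism ?E ?E P P'" and Q: "homeomorphism ?E ?E Q Q'"
    and PQ: "\<And>a. a \<in> f ` A \<Longrightarrow> Q (Q (P (P a))) = (f \<circ> (h \<circ> g)) a"
    using extend_coord_space [OF n, of "f ` A" "f ` Z"] A(1) Z(1) by (metis countable_image)
  \<comment> \<open>Conjugation by the projection, with the pole \<open>p\<close> as fixed
    point.\<close>
  define lift where "lift = (\<lambda>F. (g \<circ> (F \<circ> f))(p := p))"
  have lift: "\<exists>G. homeomorphism ?S ?S (lift F) G" if "homeomorphism ?E ?E F F'" for F F'
    unfolding lift_def
    using homeomorphism_extend_puncture [OF compact_unit_sphere p(1)
        homeomorphism_compose [OF homeomorphism_compose [OF fg that] homeomorphism_symD [OF fg]]]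
    by blast
  have conj: "lift F x \<in> ?S - {p}" "f (lift F x) = F (f x)"
    if "homeomorphism ?E ?E F F'" "x \<in> ?S - {p}" for F F' x
  proof -
    have "F (f x) \<in> ?E"
      using homeomorphism_image1 [OF fg] homeomorphism_image1 [OF that(1)] that(2) by blast
    then show "lift F x \<in> ?S - {p}" "f (lift F x) = F (f x)"
      using homeomorphism_image2 [OF fg] homeomorphism_apply2 [OF fg] that(2)
      unfolding lift_def by auto
  qed
  \<comment> \<open>Squares are taken after lifting, so that each factor is the square of a
    homeomorphism of the sphere.\<close>
  let ?P = "lift P \<circ> lift P" and ?Q = "lift Q \<circ> lift Q"
  have PP: "homeomorphic_map (nsphere n) (nsphere n) ?P" "Brouwer_degree2 n ?P = 1"
    and QQ: "homeomorphic_map (nsphere n) (nsphere n) ?Q" "Brouwer_degree2 n ?Q = 1"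
    using lift [OF P] lift [OF Q] homeomorphism_square_degree by blast+
  have "(?Q \<circ> ?P) a = h a" if "a \<in> A" for a
  proof -
    have a: "a \<in> ?S - {p}" and ha: "h a \<in> ?S - {p}"
      using that AS ZS k by (auto simp: homeomorphism_def)
    have gf: "\<And>x. x \<in> ?S - {p} \<Longrightarrow> g (f x) = x"
      using fg by (auto simp: homeomorphism_def)
    have "f ((?Q \<circ> ?P) a) = Q (Q (P (P (f a))))" "(?Q \<circ> ?P) a \<in> ?S - {p}"
      using conj [OF P] conj [OF Q] a by simp_all
    moreover have "Q (Q (P (P (f a)))) = f (h a)"
      using PQ that gf [OF a] by simp
    ultimately show ?thesis
      using gf ha by metis
  qed
  moreover have "homeomorphic_map (nsphere n) (nsphere n) (?Q \<circ> ?P)"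
    using PP(1) QQ(1) by (rule homeomorphic_map_compose)
  moreover have "Brouwer_degree2 n (?Q \<circ> ?P) = 1"
    using PP QQ by (simp add: Brouwer_degree2_compose homeomorphic_imp_continuous_map)
  ultimately show ?thesis
    by blast
qed

theorem theorem1p1:
  fixes n :: nat
    and A Z :: "(nat \<Rightarrow> real) set"
    and h :: "(nat \<Rightarrow> real) \<Rightarrow> nat \<Rightarrow> real"
  assumes "n \<ge> 2"
    and "countable A" and "compactin (nsphere n) A"
    and "countable Z" and "compactin (nsphere n) Z"
    and "homeomorphic_map (subtopology (nsphere n) A) (subtopology (nsphere n) Z) h"
  shows "(\<exists>h'. homeomorphic_map (nsphere n) (nsphere n) h' \<and> (\<forall>x\<in>A. h' x = h x)) \<and>
    (\<exists>h'. homeomorphic_map (nsphere n) (nsphere n) h' \<and> (\<forall>x\<in>A. h' x = h x) \<and>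
      orientation_reversing n h') \<and>
    (\<exists>h'. homeomorphic_map (nsphere n) (nsphere n) h' \<and> (\<forall>x\<in>A. h' x = h x) \<and>
      orientation_preserving n h')"
proof -
  obtain h1 where h1: "homeomorphic_map (nsphere n) (nsphere n) h1" "\<forall>x\<in>A. h1 x = h x"
      "Brouwer_degree2 n h1 = 1"
    using extend_degree_1 assms by blast
  let ?r = "\<lambda>(x::nat \<Rightarrow> real) i. if i = 0 then - x i else x i"
  have r: "homeomorphic_map (nsphere n) (nsphere n) ?r"
    unfolding homeomorphic_map_maps homeomorphic_maps_def
    using continuous_map_nsphere_reflection [of n 0] by (intro exI [of _ ?r]) auto
  have rr: "?r (?r x) = x" for x
    by auto
  have AS: "A \<subseteq> topspace (nsphere n)"
    using assms(3) compactin_subset_topspace by blast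
  have rA: "compactin (nsphere n) (?r ` A)"
    using assms(3) r by (blast intro: image_compactin homeomorphic_imp_continuous_map)
  \<comment> \<open>The involution \<open>?r\<close> carries the reflected set back onto
    \<open>A\<close>; the intersections with the whole sphere match the rule for restricting
    homeomorphisms.\<close>
  have "?r ` (topspace (nsphere n) \<inter> ?r ` A) = topspace (nsphere n) \<inter> A"
    using AS compactin_subset_topspace [OF rA] by (simp only: inf.absorb2 image_image rr image_ident)
  then have "homeomorphic_map (subtopology (nsphere n) (?r ` A)) (subtopology (nsphere n) A) ?r"
    using r by (rule homeomorphic_map_subtopologies [rotated])
  then have "homeomorphic_map (subtopology (nsphere n) (?r ` A)) (subtopology (nsphere n) Z) (h \<circ> ?r)"
    using assms(6) by (rule homeomorphic_map_compose)
  \<comment> \<open>The reflected set is again countable and compact. Precomposing \<open>h2\<close>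
    with \<open>?r\<close> gives \<open>h\<close> back on \<open>A\<close> and changes the degree to
    -1.\<close>
  then have "\<exists>h2. homeomorphic_map (nsphere n) (nsphere n) h2 \<and> (\<forall>x\<in>?r ` A. h2 x = (h \<circ> ?r) x) \<and>
      Brouwer_degree2 n h2 = 1"
    using assms(1,2,4,5) rA by (intro extend_degree_1 countable_image)
  then obtain h2 where h2: "homeomorphic_map (nsphere n) (nsphere n) h2" "\<forall>x\<in>?r ` A. h2 x = (h \<circ> ?r) x"
      "Brouwer_degree2 n h2 = 1"
    by blast
  have "homeomorphic_map (nsphere n) (nsphere n) (h2 \<circ> ?r)"
    using r h2(1) by (rule homeomorphic_map_compose)
  moreover have "\<forall>x\<in>A. (h2 \<circ> ?r) x = h x"
    using h2(2) rr by simp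
  moreover have "Brouwer_degree2 n (h2 \<circ> ?r) = -1"
    using Brouwer_degree2_compose [of n ?r h2] r h2 Brouwer_degree2_reflection [of n]
    by (simp add: homeomorphic_imp_continuous_map)
  ultimately show ?thesis
    using h1 unfolding orientation_preserving_def orientation_reversing_def by blast
qed

end
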